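(* The Banach space $L_1([0,1])$ (with Lebesgue measure) has no besselian Schauder frame.
   Context: Let $X$ be a Banach space over $\mathbb{K}\in\{\mathbb{R},\mathbb{C}\}$ with dual $X^*$, and let $\mathbb{I}$ be either $\mathbb{N}^*=\{1,2,3,\dots\}$ or $\{1,\dots,r\}$ for some $r\in\mathbb{N}^*$. A Schauder frame of $X$ is a sequence $((x_n,y_n^* ))_{n\in\mathbb{I}}$ of elements of $X\times X^*$ such that for every $x\in X$ one has $\sum_{n\in\mathbb{I}} y_n^*(x)x_n=x$ (when $\mathbb{I}=\mathbb{N}^*$: the series $\sum y_n^*(x)x_n$ converges in the norm of $X$ to $x$). It is a besselian Schauder frame if moreover there is a constant $A>0$ such that $\sum_{n\in\mathbb{I}}|y_n^*(x)|\,|y^*(x_n)|\le A\|x\|_X\|y^*\|_{X^*}$ for all $(x,y^* )\in X\times X^*$. The space $L_1([0,1])$ is the space of ($\mathbb{K}$-valued) Lebesgue integrable functions with its usual norm. *)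

theory Defs
  imports "HOL-Analysis.Analysis"
begin

section \<open>The Banach space of Lebesgue integrable functions on the unit interval\<close>

definition L1_rel :: "(real \<Rightarrow> 'k::{banach,second_countable_topology}) \<Rightarrow> (real \<Rightarrow> 'k) \<Rightarrow> bool" where
  "L1_rel f g \<longleftrightarrow> integrable (lebesgue_on {0..1}) f \<and> integrable (lebesgue_on {0..1}) g \<and>
     (AE t in lebesgue_on {0..1}. f t = g t)"

lemma part_equivp_L1_rel: "part_equivp L1_rel"
proof (rule part_equivpI)
  show "\<exists>f. L1_rel f f"
    by (rule exI[of _ "\<lambda>_. 0"]) (simp add: L1_rel_def)
  show "symp L1_rel"
    by (auto simp: symp_def L1_rel_def elim: eventually_mono)
  show "transp L1_rel"
    unfolding transp_def L1_rel_def by (auto elim: eventually_elim2)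
qed

quotient_type (overloaded) 'k L1 = "real \<Rightarrow> 'k::{banach,second_countable_topology}" / partial: L1_rel
  by (rule part_equivp_L1_rel)

instantiation L1 :: ("{banach,second_countable_topology}") real_vector
begin

lift_definition zero_L1 :: "'a L1" is "\<lambda>_. 0"
  by (simp add: L1_rel_def)

lift_definition plus_L1 :: "'a L1 \<Rightarrow> 'a L1 \<Rightarrow> 'a L1" is "\<lambda>f g t. f t + g t"
  unfolding L1_rel_def by (auto elim: eventually_elim2)

lift_definition uminus_L1 :: "'a L1 \<Rightarrow> 'a L1" is "\<lambda>f t. - f t"
  unfolding L1_rel_def by (auto elim: eventually_mono)

lift_definition minus_L1 :: "'a L1 \<Rightarrow> 'a L1 \<Rightarrow> 'a L1" is "\<lambda>f g t. f t - g t"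
  unfolding L1_rel_def by (auto elim: eventually_elim2)

lift_definition scaleR_L1 :: "real \<Rightarrow> 'a L1 \<Rightarrow> 'a L1" is "\<lambda>r f t. r *\<^sub>R f t"
  unfolding L1_rel_def by (auto elim: eventually_mono)

instance
proof
  fix a b :: real and f g h :: "'a L1"
  show "f + g + h = f + (g + h)"
    by transfer (simp add: L1_rel_def add.assoc)
  show "f + g = g + f"
    by transfer (simp add: L1_rel_def add.commute)
  show "0 + f = f" by transfer (simp add: L1_rel_def)
  show "- f + f = 0" by transfer (simp add: L1_rel_def)
  show "f - g = f + - g" by transfer (simp add: L1_rel_def)
  show "a *\<^sub>R (f + g) = a *\<^sub>R f + a *\<^sub>R g"
    by transfer (simp add: L1_rel_def scaleR_add_right)
  show "(a + b) *\<^sub>R f = a *\<^sub>R f + b *\<^sub>R f"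
    by transfer (simp add: L1_rel_def scaleR_add_left)
  show "a *\<^sub>R b *\<^sub>R f = (a * b) *\<^sub>R f" by transfer (simp add: L1_rel_def)
  show "1 *\<^sub>R f = f" by transfer (simp add: L1_rel_def)
qed

end

instantiation L1 :: ("{banach,second_countable_topology}") real_normed_vector
begin

lift_definition norm_L1 :: "'a L1 \<Rightarrow> real" is "\<lambda>f. \<integral>t. norm (f t) \<partial>lebesgue_on {0..1}"
proof -
  fix f g :: "real \<Rightarrow> 'a"
  assume "L1_rel f g"
  then have [measurable]: "integrable (lebesgue_on {0..1}) f" "integrable (lebesgue_on {0..1}) g"
    and ae: "AE t in lebesgue_on {0..1}. f t = g t"
    by (auto simp: L1_rel_def)
  show "(\<integral>t. norm (f t) \<partial>lebesgue_on {0..1}) = (\<integral>t. norm (g t) \<partial>lebesgue_on {0..1})"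
    by (rule integral_cong_AE) (use ae in \<open>auto elim: eventually_mono\<close>)
qed

definition dist_L1 :: "'a L1 \<Rightarrow> 'a L1 \<Rightarrow> real" where
  "dist_L1 f g = norm (f - g)"

definition sgn_L1 :: "'a L1 \<Rightarrow> 'a L1" where
  "sgn_L1 f = f /\<^sub>R norm f"

definition uniformity_L1 :: "('a L1 \<times> 'a L1) filter" where
  "uniformity_L1 = (INF e\<in>{0<..}. principal {(f, g). dist f g < e})"

definition open_L1 :: "'a L1 set \<Rightarrow> bool" where
  "open_L1 U \<longleftrightarrow> (\<forall>f\<in>U. \<forall>\<^sub>F (f', g) in uniformity. f' = f \<longrightarrow> g \<in> U)"

instance
proof
  fix a :: real and f g :: "'a L1" and U :: "'a L1 set"
  show "dist f g = norm (f - g)" by (rule dist_L1_def)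
  show "sgn f = f /\<^sub>R norm f" by (rule sgn_L1_def)
  show "uniformity = (INF e\<in>{0<..}. principal {(f, g::'a L1). dist f g < e})"
    by (rule uniformity_L1_def)
  show "open U \<longleftrightarrow> (\<forall>f\<in>U. \<forall>\<^sub>F (f', g) in uniformity. f' = f \<longrightarrow> g \<in> U)"
    by (rule open_L1_def)
  show "norm f = 0 \<longleftrightarrow> f = 0"
    by transfer (simp add: L1_rel_def integral_nonneg_eq_0_iff_AE)
  show "norm (f + g) \<le> norm f + norm g"
  proof (transfer, unfold L1_rel_def)
    fix f g :: "real \<Rightarrow> 'a"
    let ?M = "lebesgue_on {0..1::real}"
    assume "integrable ?M f \<and> integrable ?M f \<and> (AE t in ?M. f t = f t)"
      "integrable ?M g \<and> integrable ?M g \<and> (AE t in ?M. g t = g t)"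
    then have "(\<integral>t. norm (f t + g t) \<partial>?M) \<le> (\<integral>t. norm (f t) + norm (g t) \<partial>?M)"
      by (intro integral_mono) (auto intro: norm_triangle_ineq)
    also have "\<dots> = (\<integral>t. norm (f t) \<partial>?M) + (\<integral>t. norm (g t) \<partial>?M)"
      using \<open>integrable ?M f \<and> _\<close> \<open>integrable ?M g \<and> _\<close> by simp
    finally show "(\<integral>t. norm (f t + g t) \<partial>?M) \<le> (\<integral>t. norm (f t) \<partial>?M) + (\<integral>t. norm (g t) \<partial>?M)" .
  qed
  show "norm (a *\<^sub>R f) = \<bar>a\<bar> * norm f"
    by transfer simp
qed

end

instance L1 :: ("{banach,second_countable_topology}") banach
proof
  fix X :: "nat \<Rightarrow> 'a L1"
  assume "Cauchy X"
  let ?M = "lebesgue_on {0..1::real}"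
  define s where "s n = rep_L1 (X n)" for n
  have rel: "L1_rel (s n) (s n)" and X: "X n = abs_L1 (s n)" for n
    unfolding s_def
    using Quotient3_L1 Quotient3_rep_reflp Quotient3_abs_rep by metis+
  then have int: "integrable ?M (s n)" for n
    by (simp add: L1_rel_def)
  note [measurable] = int
  have dist_X: "dist (X i) (abs_L1 g) = (\<integral>t. norm (s i t - g t) \<partial>?M)"
    if g: "integrable ?M g" for i g
  proof -
    have "L1_rel g g" "L1_rel (\<lambda>t. s i t - g t) (\<lambda>t. s i t - g t)"
      using int g by (auto simp: L1_rel_def)
    then show ?thesis
      using rel by (simp add: X dist_norm minus_L1.abs_eq norm_L1.abs_eq)
  qed
  have cauchy: "\<exists>N. \<forall>i\<ge>N. \<forall>j\<ge>N. (\<integral>t. norm (s i t - s j t) \<partial>?M) < e" if "e > 0" for e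
    using \<open>Cauchy X\<close> that dist_X[OF int] by (simp add: Cauchy_def flip: X)
  obtain r where r: "strict_mono r" and ae: "AE t in ?M. Cauchy (\<lambda>i. s (r i) t)"
    using cauchy_L1_AE_cauchy_subseq[OF int cauchy] by blast
  define g where "g t = lim (\<lambda>i. s (r i) t)" for t
  have [measurable]: "g \<in> borel_measurable ?M"
    unfolding g_def by measurable
  have lim: "AE t in ?M. (\<lambda>i. s (r i) t) \<longlonglongrightarrow> g t"
    using ae by eventually_elim (simp add: g_def Cauchy_convergent convergent_LIMSEQ_iff[symmetric])
  have bound: "(\<integral>\<^sup>+t. norm (s i t - g t) \<partial>?M) \<le> ennreal e"
    if "e > 0" and N: "\<forall>i\<ge>N. \<forall>j\<ge>N. (\<integral>t. norm (s i t - s j t) \<partial>?M) < e" and "i \<ge> N" for i N e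
  proof -
    have "(\<integral>\<^sup>+t. norm (s i t - g t) \<partial>?M) = (\<integral>\<^sup>+t. liminf (\<lambda>k. ennreal (norm (s i t - s (r k) t))) \<partial>?M)"
    proof (rule nn_integral_cong_AE, use lim in eventually_elim)
      fix t assume "(\<lambda>k. s (r k) t) \<longlonglongrightarrow> g t"
      then have "(\<lambda>k. ennreal (norm (s i t - s (r k) t))) \<longlonglongrightarrow> ennreal (norm (s i t - g t))"
        by (intro tendsto_intros)
      then show "ennreal (norm (s i t - g t)) = liminf (\<lambda>k. ennreal (norm (s i t - s (r k) t)))"
        by (rule lim_imp_Liminf[OF sequentially_bot, symmetric])
    qed
    also have "\<dots> \<le> liminf (\<lambda>k. \<integral>\<^sup>+t. ennreal (norm (s i t - s (r k) t)) \<partial>?M)"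
      by (rule nn_integral_liminf) measurable
    also have "\<dots> \<le> ennreal e"
    proof (rule order_trans[OF Liminf_le_Limsup Limsup_bounded])
      show "\<forall>\<^sub>F k in sequentially. (\<integral>\<^sup>+t. ennreal (norm (s i t - s (r k) t)) \<partial>?M) \<le> ennreal e"
        using eventually_ge_at_top[of N]
      proof eventually_elim
        fix k assume "N \<le> k"
        then have "N \<le> r k"
          using seq_suble[OF r, of k] by linarith
        then have "(\<integral>t. norm (s i t - s (r k) t) \<partial>?M) \<le> e"
          using N \<open>i \<ge> N\<close> by (simp add: less_imp_le)
        then show "(\<integral>\<^sup>+t. ennreal (norm (s i t - s (r k) t)) \<partial>?M) \<le> ennreal e"
          using int by (subst nn_integral_eq_integral) (auto intro: ennreal_leI)
      qed
    qed simp
    finally show ?thesis .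
  qed
  have g: "integrable ?M g"
  proof -
    obtain N where N: "\<forall>i\<ge>N. \<forall>j\<ge>N. (\<integral>t. norm (s i t - s j t) \<partial>?M) < 1"
      using cauchy[of 1] by auto
    have "integrable ?M (\<lambda>t. s N t - g t)"
      using bound[OF _ N, of N] by (intro integrableI_bounded) (auto simp: less_top[symmetric] top_unique)
    from Bochner_Integration.integrable_diff[OF int[of N] this] show ?thesis
      by simp
  qed
  have "X \<longlonglongrightarrow> abs_L1 g"
  proof (rule metric_LIMSEQ_I)
    fix e :: real assume "e > 0"
    then obtain N where N: "\<forall>i\<ge>N. \<forall>j\<ge>N. (\<integral>t. norm (s i t - s j t) \<partial>?M) < e / 2"
      using cauchy[of "e / 2"] by auto
    have "dist (X i) (abs_L1 g) < e" if "i \<ge> N" for i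
    proof -
      have "ennreal (\<integral>t. norm (s i t - g t) \<partial>?M) \<le> ennreal (e / 2)"
        using bound[OF _ N that] \<open>e > 0\<close> int g by (subst nn_integral_eq_integral[symmetric]) auto
      then show ?thesis
        using \<open>e > 0\<close> by (simp add: dist_X[OF g] ennreal_le_iff)
    qed
    then show "\<exists>N. \<forall>i\<ge>N. dist (X i) (abs_L1 g) < e" by blast
  qed
  then show "convergent X" by (rule convergentI)
qed

lift_definition L1_scale ::
    "'k::{real_normed_field,banach,second_countable_topology} \<Rightarrow> 'k L1 \<Rightarrow> 'k L1"
  is "\<lambda>c f t. c * f t"
  unfolding L1_rel_def by (auto elim: eventually_mono)


section \<open>Banach spaces over the real or complex scalars\<close>

text \<open>
  The library has no class of complex normed spaces. A Banach space over the scalar field \<open>'k\<close>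
  (real or complex) is a type of class \<^class>\<open>banach\<close>, which carries the norm and the underlying
  real structure, together with a scalar multiplication \<open>smul\<close> by \<open>'k\<close> compatible with both.
\<close>

locale banach_space_over = vector_space smul
  for smul :: "'k::real_normed_field \<Rightarrow> 'a::banach \<Rightarrow> 'a" +
  assumes norm_smul: "norm (smul c v) = norm c * norm v"
    and smul_of_real: "smul (of_real r) v = r *\<^sub>R v"

lemma banach_space_over_L1:
  "banach_space_over
     (L1_scale :: 'k::{real_normed_field,banach,second_countable_topology} \<Rightarrow> 'k L1 \<Rightarrow> 'k L1)"
proof
  fix a b :: 'k and f g :: "'k L1" and r :: real
  show "L1_scale a (f + g) = L1_scale a f + L1_scale a g"
    by transfer (simp add: L1_rel_def distrib_left)
  show "L1_scale (a + b) f = L1_scale a f + L1_scale b f"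
    by transfer (simp add: L1_rel_def distrib_right)
  show "L1_scale a (L1_scale b f) = L1_scale (a * b) f"
    by transfer (simp add: L1_rel_def mult.assoc)
  show "L1_scale 1 f = f" by transfer (simp add: L1_rel_def)
  show "norm (L1_scale a f) = norm a * norm f"
    by transfer (simp add: norm_mult)
  show "L1_scale (of_real r) f = r *\<^sub>R f"
    by transfer (simp add: L1_rel_def scaleR_conv_of_real)
qed

text \<open>
  The dual space; the norm of a functional \<open>f\<close> in it is \<^term>\<open>onorm f\<close>. Since
  \<^const>\<open>bounded_linear\<close> is real linearity, homogeneity over \<open>'k\<close> is required separately.
\<close>

definition dual_space :: "('k::real_normed_field \<Rightarrow> 'a::banach \<Rightarrow> 'a) \<Rightarrow> ('a \<Rightarrow> 'k) set" where
  "dual_space smul = {f. bounded_linear f \<and> (\<forall>c v. f (smul c v) = c * f v)}"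


section \<open>Besselian Schauder frames\<close>

definition frame_index_set :: "nat set \<Rightarrow> bool" where
  "frame_index_set I \<longleftrightarrow> I = {1..} \<or> (\<exists>r\<ge>1. I = {1..r})"

text \<open>
  The values of \<open>x\<close> and \<open>y\<close> outside \<open>I\<close> are irrelevant. Extending the terms by \<open>0\<close> outside \<open>I\<close>
  makes \<^const>\<open>sums\<close> the ordered series for \<open>I = {1..}\<close> and the finite sum for \<open>I = {1..r}\<close>.
\<close>

definition schauder_frame ::
    "('k::real_normed_field \<Rightarrow> 'a::banach \<Rightarrow> 'a) \<Rightarrow> nat set \<Rightarrow> (nat \<Rightarrow> 'a) \<Rightarrow> (nat \<Rightarrow> 'a \<Rightarrow> 'k) \<Rightarrow> bool" where
  "schauder_frame smul I x y \<longleftrightarrow>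
     frame_index_set I \<and> (\<forall>n\<in>I. y n \<in> dual_space smul) \<and>
     (\<forall>v. (\<lambda>n. if n \<in> I then smul (y n v) (x n) else 0) sums v)"

text \<open>
  The terms below are nonnegative, so that unordered summability is convergence of the series;
  it is demanded explicitly because \<^const>\<open>infsum\<close> is \<open>0\<close> on non-summable families.
\<close>

definition besselian_schauder_frame ::
    "('k::real_normed_field \<Rightarrow> 'a::banach \<Rightarrow> 'a) \<Rightarrow> nat set \<Rightarrow> (nat \<Rightarrow> 'a) \<Rightarrow> (nat \<Rightarrow> 'a \<Rightarrow> 'k) \<Rightarrow> bool" where
  "besselian_schauder_frame smul I x y \<longleftrightarrow>
     schauder_frame smul I x y \<and>
     (\<exists>A>0. \<forall>v. \<forall>f\<in>dual_space smul.
        (\<lambda>n. norm (y n v) * norm (f (x n))) summable_on I \<and>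
        (\<Sum>\<^sub>\<infinity>n\<in>I. norm (y n v) * norm (f (x n))) \<le> A * norm v * onorm f)"

end

theory Submission
  imports Defs
begin

text \<open>
  Write \<open>T\<^sub>h f = \<integral> h f\<close> for a real function \<open>h\<close> with \<open>\<bar>h\<bar> \<le> 1\<close> and \<open>v\<^sub>S = 1\<^sub>S / \<mu>(S)\<close> for a set \<open>S\<close>
  of positive measure. A besselian frame expands \<open>T\<^sub>h v\<^sub>S\<close> as the series of the numbers
  \<open>c\<^sub>n(S, h) = y\<^sub>n(v\<^sub>S) T\<^sub>h(x\<^sub>n)\<close>, and bounds \<open>\<Sum>\<^sub>n \<bar>c\<^sub>n(S, h)\<bar>\<close> by a constant \<open>A\<close> independent of \<open>S\<close>
  and \<open>h\<close>. A gliding hump shows that these absolute sums are unbounded.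

  Let \<open>h\<close> be constant on \<open>S\<close> with value \<open>a = \<plusminus>1/3\<close>, so that \<open>\<Sum>\<^sub>n c\<^sub>n(S, h) = a\<close>, and choose \<open>N\<close> such that
  the first \<open>N\<close> terms nearly sum to \<open>a\<close>. Lebesgue measure is nonatomic, so there is \<open>B \<subseteq> S\<close> with half the
  measure of \<open>S\<close> such that the signed function \<open>g = 2 1\<^sub>B - 1\<^sub>S\<close> is almost annihilated by the finitely many
  \<open>y\<^sub>n\<close> and almost orthogonal to the finitely many \<open>x\<^sub>n\<close> with \<open>n < N\<close> (\<open>balanced_subset_L1\<close>). Now
  \<open>v\<^sub>B = v\<^sub>S + g / \<mu>(S)\<close>, and \<open>h' = h - 2 a g\<close> equals \<open>-a\<close> on \<open>B\<close> and \<open>3 a = \<plusminus>1\<close> on \<open>S - B\<close>, so that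
  still \<open>\<bar>h'\<bar> \<le> 1\<close>. Passing from \<open>(S, h)\<close> to \<open>(B, h')\<close> hardly changes the first \<open>N\<close> terms, whereas the sum of
  the whole series jumps from \<open>a\<close> to \<open>-a\<close>. The terms from \<open>N\<close> on must therefore account for nearly
  \<open>2/3\<close>, and the absolute sum grows by at least \<open>1/2\<close>. Since \<open>(B, h')\<close> has the same shape as \<open>(S, h)\<close>,
  the step can be repeated without end.
\<close>

section \<open>Balanced halves of a set\<close>

abbreviation unit_lebesgue :: "real measure" where
  "unit_lebesgue \<equiv> lebesgue_on {0..1}"

lemma finite_measure_unit_lebesgue: "finite_measure unit_lebesgue"
  by (intro finite_measureI) (simp add: emeasure_restrict_space space_restrict_space)

lemma set_integrable_unit_lebesgue:
  fixes w :: "real \<Rightarrow> 'b::{banach,second_countable_topology}"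
  assumes "integrable unit_lebesgue w" "B \<in> sets unit_lebesgue"
  shows "set_integrable unit_lebesgue B w"
  unfolding set_integrable_def using assms(2,1) by (rule integrable_mult_indicator)

lemma Ioc_in_sets_unit_lebesgue:
  fixes a b :: real
  assumes "0 \<le> a" "b \<le> 1"
  shows "{a<..b} \<in> sets unit_lebesgue"
  using assms by (subst sets_restrict_space_iff) auto

lemma continuous_on_set_integral_from_0:
  fixes w :: "real \<Rightarrow> real"
  assumes "integrable unit_lebesgue w"
  shows "continuous_on {0..1} (\<lambda>t. LINT s:{0..t}|unit_lebesgue. w s)"
proof -
  have int: "w integrable_on {0..1}"
    using assms by (rule integrable_on_lebesgue_on) simp
  have "(LINT s:{0..t}|unit_lebesgue. w s) = integral {0..t} w" if "t \<in> {0..1}" for t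
  proof -
    have "integrable unit_lebesgue (\<lambda>s. indicator {0..t} s *\<^sub>R w s)"
      using that by (intro integrable_mult_indicator assms) (auto simp: sets_restrict_space_iff)
    then have "(LINT s:{0..t}|unit_lebesgue. w s) = integral {0..1} (\<lambda>s. indicator {0..t} s *\<^sub>R w s)"
      unfolding set_lebesgue_integral_def by (rule lebesgue_integral_eq_integral) simp
    also have "\<dots> = integral {0..1} (\<lambda>s. if s \<in> {0..t} then w s else 0)"
      by (rule integral_cong) auto
    also have "\<dots> = integral ({0..t} \<inter> {0..1}) w"
      by (rule integral_restrict_Int)
    also have "{0..t} \<inter> {0..1} = {0..t}"
      using that by auto
    finally show ?thesis .
  qed
  then show ?thesis
    using indefinite_integral_continuous_1[OF int] by (subst continuous_on_cong[OF refl]) auto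
qed

text \<open>
  The measure of \<open>D \<inter> {0..t}\<close> is continuous in \<open>t\<close>, so the intermediate value theorem applies.
\<close>

lemma half_measure_subset:
  assumes D: "D \<in> sets unit_lebesgue"
  obtains C where "C \<in> sets unit_lebesgue" "C \<subseteq> D"
    "measure unit_lebesgue C = measure unit_lebesgue D / 2"
proof -
  note fin = finite_measure_unit_lebesgue
  have sub: "D \<subseteq> {0..1}"
    using sets.sets_into_space[OF D] by simp
  have meas: "D \<inter> {0..t} \<in> sets unit_lebesgue" for t
    using D by (auto simp: sets_restrict_space_iff)
  have eq: "(LINT s:{0..t}|unit_lebesgue. indicator D s :: real) = measure unit_lebesgue (D \<inter> {0..t})" for t
  proof -
    have "(LINT s:{0..t}|unit_lebesgue. indicator D s :: real) = (LINT s|unit_lebesgue. indicator (D \<inter> {0..t}) s)"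
      unfolding set_lebesgue_integral_def by (rule Bochner_Integration.integral_cong) (auto simp: indicator_def)
    then show ?thesis
      using meas sets.sets_into_space[OF meas[of t]] by (simp add: Int_absorb2)
  qed
  have "integrable unit_lebesgue (indicator D :: real \<Rightarrow> real)"
    using D fin by (intro integrable_real_indicator) (auto simp: finite_measure.emeasure_finite less_top[symmetric])
  from continuous_on_set_integral_from_0[OF this]
  have cont: "continuous_on {0..1} (\<lambda>t. measure unit_lebesgue (D \<inter> {0..t}))"
    by (simp add: eq)
  have "measure unit_lebesgue (D \<inter> {0..0::real}) \<le> measure unit_lebesgue {0::real}"
    using sub by (intro finite_measure.finite_measure_mono[OF fin]) (auto simp: sets_restrict_space_iff)
  also have "\<dots> = 0"
    by (simp add: measure_restrict_space)
  finally have l: "measure unit_lebesgue (D \<inter> {0..0::real}) \<le> measure unit_lebesgue D / 2"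
    by (simp add: order_trans[OF _ measure_nonneg])
  have r: "measure unit_lebesgue D / 2 \<le> measure unit_lebesgue (D \<inter> {0..1})"
    using sub by (subst Int_absorb2) auto
  obtain t where "measure unit_lebesgue (D \<inter> {0..t}) = measure unit_lebesgue D / 2"
    using IVT'[OF l r _ cont] by auto
  with that[OF meas[of t]] show thesis by auto
qed

lemma integral_over_short_intervals_small:
  fixes w :: "real \<Rightarrow> real"
  assumes w: "integrable unit_lebesgue w" and "\<eta> > 0"
  obtains m :: nat where "m > 0"
    "\<And>i. i < m \<Longrightarrow> (LINT s:{real i / m<..real (Suc i) / m}|unit_lebesgue. w s) \<le> \<eta>"
proof -
  let ?F = "\<lambda>t. LINT s:{0..t}|unit_lebesgue. w s"
  note si = set_integrable_unit_lebesgue[OF w]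
  have "uniformly_continuous_on {0..1} ?F"
    by (rule compact_uniformly_continuous[OF continuous_on_set_integral_from_0[OF w]]) simp
  then obtain d where "d > 0"
    and d: "\<And>s t. s \<in> {0..1} \<Longrightarrow> t \<in> {0..1} \<Longrightarrow> dist s t < d \<Longrightarrow> dist (?F s) (?F t) < \<eta>"
    unfolding uniformly_continuous_on_def using \<open>\<eta> > 0\<close> by metis
  obtain k :: nat where k: "inverse (real (Suc k)) < d"
    using reals_Archimedean[OF \<open>d > 0\<close>] by blast
  show thesis
  proof (rule that)
    show "Suc k > 0" by simp
    fix i assume i: "i < Suc k"
    let ?s = "real i / real (Suc k)" and ?t = "real (Suc i) / real (Suc k)"
    have st: "?s \<in> {0..1}" "?t \<in> {0..1}" "?s \<le> ?t"
      using i by (auto simp: divide_simps)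
    have "?t - ?s = inverse (real (Suc k))"
      by (simp add: field_simps)
    then have "dist ?t ?s < d"
      using k st(3) by (simp add: dist_real_def)
    then have "?F ?t - ?F ?s \<le> \<eta>"
      using d[OF st(2,1)] by (simp add: dist_real_def)
    moreover have "?F ?t = ?F ?s + (LINT s:{?s<..?t}|unit_lebesgue. w s)"
    proof -
      have "{0..b} = {0..a} \<union> {a<..b}" if "0 \<le> a" "a \<le> b" for a b :: real
        using that by auto
      from this[of ?s ?t] have "{0..?t} = {0..?s} \<union> {?s<..?t}" "{0..?s} \<inter> {?s<..?t} = {}"
        using st by auto
      moreover have "{0..?s} \<in> sets unit_lebesgue"
        using st by (subst sets_restrict_space_iff) auto
      moreover have "{?s<..?t} \<in> sets unit_lebesgue"
        using st by (intro Ioc_in_sets_unit_lebesgue) simp_all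
      ultimately show ?thesis
        by (metis set_integral_Un si)
    qed
    ultimately show "(LINT s:{?s<..?t}|unit_lebesgue. w s) \<le> \<eta>"
      by simp
  qed
qed


text \<open>
  An approximate form of Lyapunov's convexity theorem, for finitely many set functions that are additive
  and dominated by an integrable density. Cut \<open>A\<close> by short intervals into pieces on which the density
  has small integral, halve each piece, and give the two halves opposite signs. Each piece then
  contributes a short vector \<open>d\<close> (indexed by \<open>J\<close>) up to its sign. By the parallelogram law,
  one of \<open>s + d\<close> and \<open>s - d\<close> has squared length at most \<open>\<bar>s\<bar>\<^sup>2 + \<bar>d\<bar>\<^sup>2\<close>, so with the signs chosen one after
  the other the final vector has squared length at most the sum of the \<open>\<bar>d\<bar>\<^sup>2\<close>. That sum is at most
  \<open>card J\<close> times the largest integral of the density over a piece times its integral over \<open>A\<close>.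
\<close>

lemma balanced_subset:
  fixes \<nu> :: "'j \<Rightarrow> real set \<Rightarrow> 'b::real_inner"
  assumes J: "finite J" and A: "A \<in> sets unit_lebesgue"
    and add: "\<And>j B C. j \<in> J \<Longrightarrow> B \<in> sets unit_lebesgue \<Longrightarrow> C \<in> sets unit_lebesgue \<Longrightarrow>
      B \<inter> C = {} \<Longrightarrow> \<nu> j (B \<union> C) = \<nu> j B + \<nu> j C"
    and w: "integrable unit_lebesgue w" "\<And>t. w t \<ge> 0"
    and bound: "\<And>j B. j \<in> J \<Longrightarrow> B \<in> sets unit_lebesgue \<Longrightarrow> norm (\<nu> j B) \<le> (LINT t:B|unit_lebesgue. w t)"
    and "e > 0"
  obtains B where "B \<in> sets unit_lebesgue" "B \<subseteq> A"
    "measure unit_lebesgue B = measure unit_lebesgue A / 2"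
    "\<And>j. j \<in> J \<Longrightarrow> norm (2 *\<^sub>R \<nu> j B - \<nu> j A) \<le> e"
proof -
  let ?I = "\<lambda>B. LINT t:B|unit_lebesgue. w t"
  let ?\<mu> = "measure unit_lebesgue"
  note fin = finite_measure_unit_lebesgue
  have sub: "A \<subseteq> {0..1}"
    using sets.sets_into_space[OF A] by simp
  note si = set_integrable_unit_lebesgue[OF w(1)]
  have I_nonneg: "?I B \<ge> 0" for B
    unfolding set_lebesgue_integral_def using w(2) by (intro integral_nonneg_AE) auto
  have I_Un: "?I (B \<union> C) = ?I B + ?I C"
    if "B \<in> sets unit_lebesgue" "C \<in> sets unit_lebesgue" "B \<inter> C = {}" for B C
    using that by (intro set_integral_Un si)
  have I_mono: "?I B \<le> ?I C"
    if "B \<in> sets unit_lebesgue" "C \<in> sets unit_lebesgue" "B \<subseteq> C" for B C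
    using I_Un[of B "C - B"] I_nonneg[of "C - B"] that by (simp add: Un_absorb1)
  \<comment> \<open>The budget: the squared length of the final vector is at most \<open>(c - 1) (e\<^sup>2 / c)\<close>; the summand 1 keeps
    \<open>c\<close> positive.\<close>
  define c where "c = real (card J) * ?I A + 1"
  have "c > 0"
    unfolding c_def using I_nonneg[of A] by (simp add: add_nonneg_pos)
  then have "e\<^sup>2 / c > 0"
    using \<open>e > 0\<close> by simp
  then obtain m :: nat where "m > 0"
    and m: "\<And>i. i < m \<Longrightarrow> ?I {real i / m<..real (Suc i) / m} \<le> e\<^sup>2 / c"
    by (rule integral_over_short_intervals_small[OF w(1)]) blast
  define A' where "A' i = A \<inter> {0..real i / m}" for i :: nat
  have A': "A' i \<in> sets unit_lebesgue" for i
    using A unfolding A'_def by (auto simp: sets_restrict_space_iff)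
  have "\<exists>B \<in> sets unit_lebesgue. B \<subseteq> A' i \<and> ?\<mu> B = ?\<mu> (A' i) / 2 \<and>
      (\<Sum>j\<in>J. (norm (2 *\<^sub>R \<nu> j B - \<nu> j (A' i)))\<^sup>2) \<le> card J * (e\<^sup>2 / c) * ?I (A' i)"
    if "i \<le> m" for i
    using that
  proof (induction i)
    \<comment> \<open>The interval \<open>{0..0}\<close> may contribute a point to \<open>A' 0\<close>, on which all set functions vanish by domination.\<close>
    case 0
    have null: "?I (A' 0) = 0" "?\<mu> (A' 0) = 0"
    proof -
      have z: "{0} \<in> null_sets unit_lebesgue"
        by (auto simp: null_sets_restrict_space)
      have "A' 0 \<subseteq> {0}"
        by (auto simp: A'_def)
      then have n: "A' 0 \<in> null_sets unit_lebesgue"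
        using A' z null_sets_subset by blast
      then show "?\<mu> (A' 0) = 0"
        by (simp add: measure_def null_setsD1)
      show "?I (A' 0) = 0"
        unfolding set_lebesgue_integral_def
        by (rule integral_eq_zero_AE, rule AE_mp[OF AE_not_in[OF n]]) auto
    qed
    then have "\<nu> j (A' 0) = 0" if "j \<in> J" for j
      using bound[OF that A'[of 0]] by simp
    moreover have "\<nu> j {} = 0" if "j \<in> J" for j
      using bound[OF that, of "{}"] by (simp add: set_lebesgue_integral_def)
    ultimately show ?case
      using null by (intro bexI[of _ "{}"]) auto
  next
    case (Suc i)
    then obtain B where B: "B \<in> sets unit_lebesgue" "B \<subseteq> A' i" "?\<mu> B = ?\<mu> (A' i) / 2"
      and IH: "(\<Sum>j\<in>J. (norm (2 *\<^sub>R \<nu> j B - \<nu> j (A' i)))\<^sup>2) \<le> card J * (e\<^sup>2 / c) * ?I (A' i)"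
      by auto
    define D where "D = A \<inter> {real i / m<..real (Suc i) / m}"
    have D: "D \<in> sets unit_lebesgue"
      using A unfolding D_def by (auto simp: sets_restrict_space_iff)
    have le: "real i / m \<le> real (Suc i) / m"
      by (simp add: divide_right_mono)
    have split: "A' (Suc i) = A' i \<union> D" and disj: "A' i \<inter> D = {}"
      using sub le by (auto simp: A'_def D_def)
    obtain C where C: "C \<in> sets unit_lebesgue" "C \<subseteq> D" "?\<mu> C = ?\<mu> D / 2"
      by (rule half_measure_subset[OF D])
    have CD: "?\<mu> (D - C) = ?\<mu> D / 2"
      using C D by (simp add: finite_measure.finite_measure_Diff[OF fin])
    have ID: "?I D \<le> e\<^sup>2 / c"
    proof -
      have "real (Suc i) / m \<le> 1" "0 \<le> real i / m"
        using Suc.prems \<open>m > 0\<close> by auto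
      then have "{real i / m<..real (Suc i) / m} \<in> sets unit_lebesgue"
        by (intro Ioc_in_sets_unit_lebesgue)
      then have "?I D \<le> ?I {real i / m<..real (Suc i) / m}"
        by (intro I_mono D) (auto simp: D_def)
      also have "\<dots> \<le> e\<^sup>2 / c"
        using Suc.prems by (intro m) simp
      finally show ?thesis .
    qed
    define s where "s j = 2 *\<^sub>R \<nu> j B - \<nu> j (A' i)" for j
    define d where "d j = 2 *\<^sub>R \<nu> j C - \<nu> j D" for j
    have \<nu>D: "\<nu> j D = \<nu> j C + \<nu> j (D - C)" if "j \<in> J" for j
      using add[OF that, of C "D - C"] C D by (simp add: Un_absorb1)
    have plus: "2 *\<^sub>R \<nu> j (B \<union> C) - \<nu> j (A' (Suc i)) = s j + d j" if "j \<in> J" for j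
    proof -
      have "\<nu> j (B \<union> C) = \<nu> j B + \<nu> j C"
        using B C disj by (intro add that) auto
      then show ?thesis
        using add[OF that A' D disj] by (simp add: split s_def d_def scaleR_add_right)
    qed
    have minus: "2 *\<^sub>R \<nu> j (B \<union> (D - C)) - \<nu> j (A' (Suc i)) = s j - d j" if "j \<in> J" for j
    proof -
      have "\<nu> j (B \<union> (D - C)) = \<nu> j B + \<nu> j (D - C)"
        using B C D disj by (intro add that) auto
      then show ?thesis
        using add[OF that A' D disj] \<nu>D[OF that]
        by (simp add: split s_def d_def algebra_simps scaleR_2)
    qed
    have d_bound: "(norm (d j))\<^sup>2 \<le> e\<^sup>2 / c * ?I D" if "j \<in> J" for j
    proof -
      have "d j = \<nu> j C - \<nu> j (D - C)"
        by (simp add: d_def \<nu>D[OF that] scaleR_2)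
      then have "norm (d j) \<le> norm (\<nu> j C) + norm (\<nu> j (D - C))"
        by (simp add: norm_triangle_ineq4)
      also have "\<dots> \<le> ?I C + ?I (D - C)"
        using C D by (intro add_mono bound that) auto
      also have "\<dots> = ?I D"
        using C D I_Un[of C "D - C"] by (simp add: Un_absorb1)
      finally have "norm (d j) \<le> ?I D" .
      then have "norm (d j) * norm (d j) \<le> (e\<^sup>2 / c) * ?I D"
        using ID \<open>e\<^sup>2 / c > 0\<close> by (intro mult_mono) auto
      then show ?thesis by (simp add: power2_eq_square)
    qed
    \<comment> \<open>The parallelogram law, summed over \<open>J\<close>, says that one of the two choices of sign stays within the budget.\<close>
    have par: "(norm (s j + d j))\<^sup>2 + (norm (s j - d j))\<^sup>2 = 2 * (norm (s j))\<^sup>2 + 2 * (norm (d j))\<^sup>2" for j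
      by (simp add: power2_norm_eq_inner inner_simps inner_commute)
    have sum_par: "(\<Sum>j\<in>J. (norm (s j + d j))\<^sup>2) + (\<Sum>j\<in>J. (norm (s j - d j))\<^sup>2)
        = 2 * (\<Sum>j\<in>J. (norm (s j))\<^sup>2) + 2 * (\<Sum>j\<in>J. (norm (d j))\<^sup>2)"
      unfolding sum.distrib[symmetric] par by (simp only: sum.distrib sum_distrib_left)
    have sum_d: "(\<Sum>j\<in>J. (norm (d j))\<^sup>2) \<le> card J * (e\<^sup>2 / c) * ?I D"
      using sum_bounded_above[of J "\<lambda>j. (norm (d j))\<^sup>2", OF d_bound] by (simp only: mult.assoc)
    have budget: "card J * (e\<^sup>2 / c) * ?I (A' (Suc i))
        = card J * (e\<^sup>2 / c) * ?I (A' i) + card J * (e\<^sup>2 / c) * ?I D"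
      unfolding split I_Un[OF A' D disj] by (rule distrib_left)
    have half: "p \<le> b \<or> q \<le> b"
      if "p + q = 2 * s + 2 * d" "s \<le> b\<^sub>1" "d \<le> b\<^sub>2" "b = b\<^sub>1 + b\<^sub>2" for p q s d b b\<^sub>1 b\<^sub>2 :: real
      using that by linarith
    note total = sum_par IH[folded s_def] sum_d budget
    from half[OF total] show ?case
    proof (elim disjE, goal_cases)
      case 1
      have "?\<mu> (B \<union> C) = ?\<mu> (A' (Suc i)) / 2"
        using B C disj unfolding split
        by (subst (1 2) finite_measure.finite_measure_Union[OF fin]) (auto simp: A' D)
      moreover have "(\<Sum>j\<in>J. (norm (2 *\<^sub>R \<nu> j (B \<union> C) - \<nu> j (A' (Suc i))))\<^sup>2)
          = (\<Sum>j\<in>J. (norm (s j + d j))\<^sup>2)"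
        by (simp add: plus)
      moreover have "B \<union> C \<in> sets unit_lebesgue"
        using B(1) C(1) D by blast
      moreover have "B \<union> C \<subseteq> A' (Suc i)"
        using B(2) C(2) unfolding split by blast
      ultimately show ?case
        using 1 by (intro bexI[of _ "B \<union> C"] conjI) (simp_all only:)
    next
      case 2
      have "?\<mu> (B \<union> (D - C)) = ?\<mu> (A' (Suc i)) / 2"
        using B C CD disj unfolding split
        by (subst (1 2) finite_measure.finite_measure_Union[OF fin]) (auto simp: A' D)
      moreover have "(\<Sum>j\<in>J. (norm (2 *\<^sub>R \<nu> j (B \<union> (D - C)) - \<nu> j (A' (Suc i))))\<^sup>2)
          = (\<Sum>j\<in>J. (norm (s j - d j))\<^sup>2)"
        by (simp add: minus)
      moreover have "B \<union> (D - C) \<in> sets unit_lebesgue"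
        using B(1) C(1) D by blast
      moreover have "B \<union> (D - C) \<subseteq> A' (Suc i)"
        using B(2) C(2) unfolding split by blast
      ultimately show ?case
        using 2 by (intro bexI[of _ "B \<union> (D - C)"] conjI) (simp_all only:)
    qed
  qed
  from this[of m] obtain B where B: "B \<in> sets unit_lebesgue" "B \<subseteq> A' m" "?\<mu> B = ?\<mu> (A' m) / 2"
    and sum: "(\<Sum>j\<in>J. (norm (2 *\<^sub>R \<nu> j B - \<nu> j (A' m)))\<^sup>2) \<le> card J * (e\<^sup>2 / c) * ?I (A' m)"
    by auto
  have A'_m: "A' m = A"
    using sub \<open>m > 0\<close> by (auto simp: A'_def)
  show thesis
  proof (rule that[of B])
    fix j assume "j \<in> J"
    then have "(norm (2 *\<^sub>R \<nu> j B - \<nu> j A))\<^sup>2 \<le> (\<Sum>j\<in>J. (norm (2 *\<^sub>R \<nu> j B - \<nu> j A))\<^sup>2)"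
      by (intro member_le_sum J) auto
    also have "\<dots> \<le> (card J * ?I A) * (e\<^sup>2 / c)"
      using sum by (simp add: A'_m mult_ac)
    also have "\<dots> \<le> c * (e\<^sup>2 / c)"
      using \<open>e\<^sup>2 / c > 0\<close> by (intro mult_right_mono) (auto simp: c_def)
    also have "\<dots> = e\<^sup>2"
      using \<open>c > 0\<close> by simp
    finally show "norm (2 *\<^sub>R \<nu> j B - \<nu> j A) \<le> e"
      by (rule power2_le_imp_le) (use \<open>e > 0\<close> in simp)
  qed (use B A'_m in auto)
qed


section \<open>Pairing integrable functions with bounded functions\<close>

definition L1_pairing :: "(real \<Rightarrow> real) \<Rightarrow> 'k::{banach,second_countable_topology} L1 \<Rightarrow> 'k" where
  "L1_pairing h f = (\<integral>t. h t *\<^sub>R rep_L1 f t \<partial>unit_lebesgue)"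

definition L1_indicator :: "real set \<Rightarrow> 'k::{real_normed_algebra_1,banach,second_countable_topology} L1" where
  "L1_indicator A = abs_L1 (\<lambda>t. of_real (indicator A t))"

lemma abs_rep_L1: "abs_L1 (rep_L1 f) = f"
  using Quotient3_L1 by (rule Quotient3_abs_rep)

lemma L1_rel_rep_abs:
  assumes "integrable unit_lebesgue f"
  shows "L1_rel (rep_L1 (abs_L1 f)) f"
  using assms by (intro Quotient3_rep_abs[OF Quotient3_L1]) (simp add: L1_rel_def)

lemma integrable_rep_L1: "integrable unit_lebesgue (rep_L1 f)"
  using Quotient3_rep_reflp[OF Quotient3_L1, of f] by (simp add: L1_rel_def)

lemma norm_L1_rep: "norm f = (\<integral>t. norm (rep_L1 f t) \<partial>unit_lebesgue)"
  using norm_L1.abs_eq[of "rep_L1 f"] integrable_rep_L1[of f] by (simp add: abs_rep_L1 L1_rel_def)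

lemma integrable_bounded_scaleR:
  fixes f :: "real \<Rightarrow> 'b::{banach,second_countable_topology}"
  assumes "h \<in> borel_measurable unit_lebesgue" "\<And>t. \<bar>h t\<bar> \<le> 1" "integrable unit_lebesgue f"
  shows "integrable unit_lebesgue (\<lambda>t. h t *\<^sub>R f t)"
  using assms(3)
proof (rule Bochner_Integration.integrable_bound)
  show "(\<lambda>t. h t *\<^sub>R f t) \<in> borel_measurable unit_lebesgue"
    using assms by (intro borel_measurable_scaleR) auto
  show "AE t in unit_lebesgue. norm (h t *\<^sub>R f t) \<le> norm (f t)"
    using assms(2) by (auto intro!: mult_left_le_one_le)
qed

lemma L1_pairing_abs:
  assumes h: "h \<in> borel_measurable unit_lebesgue" "\<And>t. \<bar>h t\<bar> \<le> 1" and f: "integrable unit_lebesgue f"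
  shows "L1_pairing h (abs_L1 f) = (\<integral>t. h t *\<^sub>R f t \<partial>unit_lebesgue)"
proof -
  have "L1_rel (rep_L1 (abs_L1 f)) f"
    using f by (rule L1_rel_rep_abs)
  then have "AE t in unit_lebesgue. rep_L1 (abs_L1 f) t = f t"
    by (simp add: L1_rel_def)
  then show ?thesis
    unfolding L1_pairing_def
    by (intro integral_cong_AE borel_measurable_integrable integrable_bounded_scaleR h f integrable_rep_L1)
      auto
qed

lemma norm_L1_pairing_le:
  assumes h: "h \<in> borel_measurable unit_lebesgue" "\<And>t. \<bar>h t\<bar> \<le> 1"
  shows "norm (L1_pairing h f) \<le> norm f"
  unfolding L1_pairing_def norm_L1_rep
proof (rule Bochner_Integration.integral_norm_bound_integral)
  show "norm (h t *\<^sub>R rep_L1 f t) \<le> norm (rep_L1 f t)" for t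
    using h(2)[of t] by (auto intro!: mult_left_le_one_le)
qed (auto intro!: integrable_bounded_scaleR h integrable_rep_L1)

lemma L1_pairing_in_dual_space:
  fixes h :: "real \<Rightarrow> real"
  assumes h: "h \<in> borel_measurable unit_lebesgue" "\<And>t. \<bar>h t\<bar> \<le> 1"
  shows "(L1_pairing h :: 'k::{real_normed_field,banach,second_countable_topology} L1 \<Rightarrow> 'k)
      \<in> dual_space L1_scale"
proof -
  have rel: "L1_rel (rep_L1 f) (rep_L1 f)" for f :: "'k L1"
    using integrable_rep_L1 by (simp add: L1_rel_def)
  have int: "integrable unit_lebesgue (\<lambda>t. h t *\<^sub>R rep_L1 f t)" for f :: "'k L1"
    by (intro integrable_bounded_scaleR h integrable_rep_L1)
  have scale: "L1_pairing h (L1_scale c f) = c * L1_pairing h f" for c and f :: "'k L1"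
  proof -
    have "L1_scale c f = abs_L1 (\<lambda>t. c * rep_L1 f t)"
      using L1_scale.abs_eq[OF rel, of c f] by (simp add: abs_rep_L1)
    then have "L1_pairing h (L1_scale c f) = (\<integral>t. h t *\<^sub>R (c * rep_L1 f t) \<partial>unit_lebesgue)"
      using L1_pairing_abs[OF h integrable_mult_right[OF integrable_rep_L1]] by simp
    also have "\<dots> = (\<integral>t. c * (h t *\<^sub>R rep_L1 f t) \<partial>unit_lebesgue)"
      by simp
    finally show ?thesis
      unfolding L1_pairing_def by (simp only: integral_mult_right_zero)
  qed
  have add: "L1_pairing h (f + g) = L1_pairing h f + L1_pairing h g" for f g :: "'k L1"
  proof -
    have "f + g = abs_L1 (\<lambda>t. rep_L1 f t + rep_L1 g t)"
      using plus_L1.abs_eq[OF rel rel, of f g] by (simp add: abs_rep_L1)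
    then have "L1_pairing h (f + g) = (\<integral>t. h t *\<^sub>R (rep_L1 f t + rep_L1 g t) \<partial>unit_lebesgue)"
      using L1_pairing_abs[OF h Bochner_Integration.integrable_add[OF integrable_rep_L1 integrable_rep_L1]]
      by simp
    then show ?thesis
      unfolding L1_pairing_def by (simp add: scaleR_add_right int)
  qed
  have "bounded_linear (L1_pairing h :: 'k L1 \<Rightarrow> 'k)"
  proof (rule bounded_linear_intro)
    fix r and f :: "'k L1"
    have "L1_pairing h (L1_scale (of_real r) f) = r *\<^sub>R L1_pairing h f"
      by (simp add: scale scaleR_conv_of_real)
    then show "L1_pairing h (r *\<^sub>R f) = r *\<^sub>R L1_pairing h f"
      by (simp add: banach_space_over.smul_of_real[OF banach_space_over_L1])
    show "norm (L1_pairing h f) \<le> norm f * 1"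
      using norm_L1_pairing_le[OF h] by simp
  qed (rule add)
  with scale show ?thesis
    by (simp add: dual_space_def)
qed

lemma onorm_L1_pairing_le:
  assumes "h \<in> borel_measurable unit_lebesgue" "\<And>t. \<bar>h t\<bar> \<le> 1"
  shows "onorm (L1_pairing h) \<le> 1"
  using norm_L1_pairing_le[OF assms] by (intro onorm_bound) simp_all

lemma integrable_of_real_indicator:
  assumes "A \<in> sets unit_lebesgue"
  shows "integrable unit_lebesgue (\<lambda>t. of_real (indicator A t) :: 'k::{real_normed_algebra_1,banach,second_countable_topology})"
proof -
  have "integrable unit_lebesgue (indicator A :: real \<Rightarrow> real)"
    using assms finite_measure_unit_lebesgue
    by (intro integrable_real_indicator) (auto simp: finite_measure.emeasure_finite less_top[symmetric])
  then show ?thesis by (rule integrable_of_real)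
qed

lemma norm_L1_indicator:
  assumes A: "A \<in> sets unit_lebesgue"
  shows "norm (L1_indicator A :: 'k::{real_normed_algebra_1,banach,second_countable_topology} L1)
      = measure unit_lebesgue A"
proof -
  let ?f = "\<lambda>t. of_real (indicator A t) :: 'k"
  have "norm (L1_indicator A :: 'k L1) = (\<integral>t. norm (?f t) \<partial>unit_lebesgue)"
    unfolding L1_indicator_def using integrable_of_real_indicator[OF A]
    by (intro norm_L1.abs_eq) (simp add: L1_rel_def)
  then show ?thesis
    using A sets.sets_into_space[OF A] by (simp add: Int_absorb2)
qed

lemma L1_indicator_Un:
  assumes "B \<in> sets unit_lebesgue" "C \<in> sets unit_lebesgue" "B \<inter> C = {}"
  shows "L1_indicator (B \<union> C) = L1_indicator B + L1_indicator C"
proof -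
  have "L1_indicator B + L1_indicator C = abs_L1 (\<lambda>t. of_real (indicator B t) + of_real (indicator C t))"
    unfolding L1_indicator_def using assms(1,2)[THEN integrable_of_real_indicator]
    by (intro plus_L1.abs_eq) (simp_all add: L1_rel_def)
  also have "(\<lambda>t. of_real (indicator B t) + of_real (indicator C t)) = (\<lambda>t. of_real (indicator (B \<union> C) t))"
    using assms(3) by (auto simp: indicator_def fun_eq_iff)
  finally show ?thesis
    unfolding L1_indicator_def by (rule sym)
qed


lemma L1_pairing_add:
  assumes "h \<in> borel_measurable unit_lebesgue" "\<And>t. \<bar>h t\<bar> \<le> 1"
    and "k \<in> borel_measurable unit_lebesgue" "\<And>t. \<bar>k t\<bar> \<le> 1"
  shows "L1_pairing (\<lambda>t. h t + c * k t) f = L1_pairing h f + c *\<^sub>R L1_pairing k f"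
proof -
  have "L1_pairing (\<lambda>t. h t + c * k t) f
      = (\<integral>t. h t *\<^sub>R rep_L1 f t + c *\<^sub>R (k t *\<^sub>R rep_L1 f t) \<partial>unit_lebesgue)"
    unfolding L1_pairing_def by (simp add: scaleR_add_left)
  also have "\<dots> = L1_pairing h f + c *\<^sub>R L1_pairing k f"
    unfolding L1_pairing_def
    by (subst Bochner_Integration.integral_add)
      (auto intro!: integrable_scaleR_right integrable_bounded_scaleR assms integrable_rep_L1
        simp del: scaleR_scaleR)
  finally show ?thesis .
qed

lemma L1_pairing_indicator:
  assumes "B \<in> sets unit_lebesgue"
  shows "L1_pairing (indicator B) f = (LINT t:B|unit_lebesgue. rep_L1 f t)"
  unfolding L1_pairing_def set_lebesgue_integral_def by simp

lemma norm_L1_pairing_indicator_le: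
  assumes "B \<in> sets unit_lebesgue"
  shows "norm (L1_pairing (indicator B) f) \<le> (LINT t:B|unit_lebesgue. norm (rep_L1 f t))"
  unfolding L1_pairing_def set_lebesgue_integral_def
  by (rule order_trans[OF integral_norm_bound]) simp

lemma L1_pairing_L1_indicator:
  assumes h: "h \<in> borel_measurable unit_lebesgue" "\<And>t. \<bar>h t\<bar> \<le> 1"
    and A: "A \<in> sets unit_lebesgue" and a: "\<And>t. t \<in> A \<Longrightarrow> h t = a"
  shows "L1_pairing h (L1_indicator A :: 'k::{real_normed_algebra_1,banach,second_countable_topology} L1)
      = of_real (a * measure unit_lebesgue A)"
proof -
  have "L1_pairing h (L1_indicator A :: 'k L1) = (\<integral>t. h t *\<^sub>R of_real (indicator A t) \<partial>unit_lebesgue)"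
    unfolding L1_indicator_def by (intro L1_pairing_abs h integrable_of_real_indicator A)
  also have "\<dots> = (\<integral>t. of_real (a * indicator A t) \<partial>unit_lebesgue)"
    using a by (intro Bochner_Integration.integral_cong) (auto simp: indicator_def of_real_def)
  also have "\<dots> = of_real (\<integral>t. a * indicator A t \<partial>unit_lebesgue)"
    by (intro integral_of_real integrable_mult_right)
      (use integrable_of_real_indicator[OF A, where 'k=real] in simp)
  also have "(\<integral>t. a * indicator A t \<partial>unit_lebesgue) = a * (\<integral>t. indicator A t \<partial>unit_lebesgue)"
    by (rule integral_mult_right_zero)
  also have "(\<integral>t. indicator A t \<partial>unit_lebesgue) = measure unit_lebesgue A"
    using sets.sets_into_space[OF A] by (simp add: Int_absorb2)
  finally show ?thesis .
qed

text \<open>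
  The set functions are \<open>B \<mapsto> y\<^sub>n(1\<^sub>B)\<close>, dominated by the constant density \<open>onorm (y n)\<close>, and
  \<open>B \<mapsto> \<integral>\<^sub>B x\<^sub>n\<close>, dominated by \<open>\<bar>x\<^sub>n\<bar>\<close>.
\<close>

lemma balanced_subset_L1:
  fixes x :: "nat \<Rightarrow> 'k::{real_normed_field,euclidean_space} L1" and y :: "nat \<Rightarrow> 'k L1 \<Rightarrow> 'k"
  assumes S: "S \<in> sets unit_lebesgue" and y: "\<And>n. bounded_linear (y n)" and "e > 0"
  obtains B where "B \<in> sets unit_lebesgue" "B \<subseteq> S"
    "measure unit_lebesgue B = measure unit_lebesgue S / 2"
    "\<And>n. n < N \<Longrightarrow> norm (y n (2 *\<^sub>R L1_indicator B - L1_indicator S)) \<le> e"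
    "\<And>n. n < N \<Longrightarrow> norm (L1_pairing (\<lambda>t. 2 * indicator B t - indicator S t) (x n)) \<le> e"
proof -
  define \<nu> where "\<nu> = case_sum (\<lambda>n B. y n (L1_indicator B)) (\<lambda>n B. L1_pairing (indicator B) (x n))"
  define w where "w t = (\<Sum>n<N. onorm (y n) + norm (rep_L1 (x n) t))" for t
  let ?J = "{..<N} <+> {..<N}"
  have int: "integrable unit_lebesgue (\<lambda>t. onorm (y n) + norm (rep_L1 (x n) t))" for n
    using integrable_rep_L1[of "x n"] finite_measure_unit_lebesgue
    by (simp add: finite_measure.integrable_const)
  have w_ge: "onorm (y n) \<le> w t" "norm (rep_L1 (x n) t) \<le> w t" if "n < N" for n t
  proof -
    have "onorm (y n) + norm (rep_L1 (x n) t) \<le> w t"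
      unfolding w_def using that by (intro member_le_sum) (auto simp: onorm_pos_le y)
    then show "onorm (y n) \<le> w t" "norm (rep_L1 (x n) t) \<le> w t"
      using onorm_pos_le[OF y[of n]] norm_ge_zero[of "rep_L1 (x n) t"] by linarith+
  qed
  have w: "integrable unit_lebesgue w" "w t \<ge> 0" for t
    unfolding w_def by (auto intro!: int sum_nonneg simp: onorm_pos_le y)
  obtain B where B: "B \<in> sets unit_lebesgue" "B \<subseteq> S"
      "measure unit_lebesgue B = measure unit_lebesgue S / 2"
      "\<And>j. j \<in> ?J \<Longrightarrow> norm (2 *\<^sub>R \<nu> j B - \<nu> j S) \<le> e"
  proof (rule balanced_subset[where J = ?J and \<nu> = \<nu>, OF _ S _ w _ \<open>e > 0\<close>])
    fix j B C assume "j \<in> ?J" and BC: "B \<in> sets unit_lebesgue" "C \<in> sets unit_lebesgue" "B \<inter> C = {}"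
    have "L1_pairing (indicator (B \<union> C)) f = L1_pairing (indicator B) f + L1_pairing (indicator C) f"
      for f :: "'k L1"
      using BC by (simp add: L1_pairing_indicator set_integral_Un set_integrable_unit_lebesgue integrable_rep_L1)
    then show "\<nu> j (B \<union> C) = \<nu> j B + \<nu> j C"
      using BC linear_add[OF bounded_linear.linear[OF y]]
      by (cases j) (simp_all add: \<nu>_def L1_indicator_Un)
  next
    fix j B assume j: "j \<in> ?J" and B: "B \<in> sets unit_lebesgue"
    have mono: "(LINT t:B|unit_lebesgue. u t) \<le> (LINT t:B|unit_lebesgue. w t)"
      if "integrable unit_lebesgue u" "\<And>t. u t \<le> w t" for u
      using that by (intro set_integral_mono set_integrable_unit_lebesgue B w)
    show "norm (\<nu> j B) \<le> (LINT t:B|unit_lebesgue. w t)"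
    proof (cases j)
      case (Inl n)
      then have "n < N" using j by auto
      have "norm (\<nu> j B) \<le> onorm (y n) * measure unit_lebesgue B"
        using onorm[OF y[of n], of "L1_indicator B"] by (simp add: Inl \<nu>_def norm_L1_indicator[OF B])
      also have "\<dots> = (LINT t:B|unit_lebesgue. onorm (y n))"
        using B sets.sets_into_space[OF B] by (simp add: set_lebesgue_integral_def Int_absorb2)
      also have "\<dots> \<le> (LINT t:B|unit_lebesgue. w t)"
        by (intro mono w_ge \<open>n < N\<close> finite_measure.integrable_const finite_measure_unit_lebesgue)
      finally show ?thesis .
    next
      case (Inr n)
      then have "n < N" using j by auto
      have "norm (\<nu> j B) \<le> (LINT t:B|unit_lebesgue. norm (rep_L1 (x n) t))"
        by (simp add: Inr \<nu>_def norm_L1_pairing_indicator_le[OF B])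
      also have "\<dots> \<le> (LINT t:B|unit_lebesgue. w t)"
        by (intro mono w_ge \<open>n < N\<close> integrable_norm integrable_rep_L1)
      finally show ?thesis .
    qed
  qed auto
  show thesis
  proof (rule that[OF B(1-3)])
    fix n assume "n < N"
    show "norm (y n (2 *\<^sub>R L1_indicator B - L1_indicator S)) \<le> e"
      using B(4)[of "Inl n"] \<open>n < N\<close> bounded_linear.linear[OF y[of n]]
      by (simp add: \<nu>_def linear_diff linear_scale InlI)
    have "L1_pairing (\<lambda>t. 2 * indicator B t - indicator S t) f
        = 2 *\<^sub>R L1_pairing (indicator B) f - L1_pairing (indicator S) f" for f :: "'k L1"
      using set_integrable_unit_lebesgue[OF integrable_rep_L1 B(1), of f]
        set_integrable_unit_lebesgue[OF integrable_rep_L1 S, of f]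
      unfolding L1_pairing_def set_integrable_def
      by (simp add: scaleR_diff_left flip: scaleR_scaleR)
    then show "norm (L1_pairing (\<lambda>t. 2 * indicator B t - indicator S t) (x n)) \<le> e"
      using B(4)[of "Inr n"] \<open>n < N\<close> by (simp add: \<nu>_def InrI)
  qed
qed

section \<open>The gliding hump\<close>

text \<open>
  The induction behind \<open>claim\<close> performs the step from \<open>(S, h)\<close> to \<open>(B, h')\<close>. Since \<open>g\<close> has mean \<open>0\<close> on \<open>S\<close>,
  the mean of \<open>h'\<close> on \<open>S\<close> is still \<open>a\<close>: the value \<open>-a\<close> on one half entails \<open>3 a\<close> on the other, and \<open>1/3\<close> is the
  largest \<open>\<bar>a\<bar>\<close> with \<open>\<bar>3 a\<bar> \<le> 1\<close>.
\<close>

lemma no_besselian_expansion: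
  fixes x :: "nat \<Rightarrow> 'k::{real_normed_field,euclidean_space} L1" and y :: "nat \<Rightarrow> 'k L1 \<Rightarrow> 'k"
  assumes y: "\<And>n. bounded_linear (y n)"
    and expansion: "\<And>v. (\<lambda>n. L1_scale (y n v) (x n)) sums v"
    and bessel: "\<And>v f N. f \<in> dual_space L1_scale \<Longrightarrow>
      (\<Sum>n<N. norm (y n v) * norm (f (x n))) \<le> A * norm v * onorm f"
    and "A > 0"
  shows False
proof -
  let ?M = unit_lebesgue
  define v where "v S = (L1_indicator S :: 'k L1) /\<^sub>R measure ?M S" for S
  have norm_v: "norm (v S) = 1" if "S \<in> sets ?M" "measure ?M S > 0" for S
    using that by (simp add: v_def norm_L1_indicator)
  have expand: "(\<lambda>n. y n (v S) * L1_pairing h (x n)) sums of_real a"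
    if S: "S \<in> sets ?M" "measure ?M S > 0" and h: "h \<in> borel_measurable ?M" "\<And>t. \<bar>h t\<bar> \<le> 1"
      and a: "\<And>t. t \<in> S \<Longrightarrow> h t = a" for S h a
  proof -
    have lin: "bounded_linear (L1_pairing h :: 'k L1 \<Rightarrow> 'k)"
      and sc: "\<And>c f. L1_pairing h (L1_scale c f) = c * L1_pairing h (f :: 'k L1)"
      using L1_pairing_in_dual_space[OF h, where 'k='k] by (auto simp: dual_space_def)
    have "(\<lambda>n. L1_pairing h (L1_scale (y n (v S)) (x n))) sums L1_pairing h (v S)"
      by (rule bounded_linear.sums[OF lin expansion])
    moreover have "L1_pairing h (v S) = of_real a"
      using S(2) unfolding v_def linear_scale[OF bounded_linear.linear[OF lin]]
      by (simp add: L1_pairing_L1_indicator[OF h S(1) a] scaleR_conv_of_real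
          flip: of_real_mult of_real_inverse)
    ultimately show ?thesis by (simp add: sc)
  qed
  have claim: "\<exists>S h a N. S \<in> sets ?M \<and> measure ?M S > 0 \<and> h \<in> borel_measurable ?M \<and> (\<forall>t. \<bar>h t\<bar> \<le> 1) \<and>
      (\<forall>t\<in>S. h t = a) \<and> \<bar>a\<bar> = 1/3 \<and> real k / 2 \<le> (\<Sum>n<N. norm (y n (v S)) * norm (L1_pairing h (x n)))"
    for k :: nat
  proof (induction k)
    case 0
    have "{0..1} \<in> sets ?M" "measure ?M {0..1} > 0"
      by (simp_all add: sets_restrict_space_iff measure_restrict_space)
    then show ?case
      by (intro exI[of _ "{0..1}"] exI[of _ "\<lambda>_. 1/3"] exI[of _ "1/3"] exI[of _ 0]) auto
  next
    case (Suc k)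
    then obtain S h a N0 where S: "S \<in> sets ?M" "measure ?M S > 0"
      and h: "h \<in> borel_measurable ?M" "\<And>t. \<bar>h t\<bar> \<le> 1" and a: "\<And>t. t \<in> S \<Longrightarrow> h t = a" "\<bar>a\<bar> = 1/3"
      and IH: "real k / 2 \<le> (\<Sum>n<N0. norm (y n (v S)) * norm (L1_pairing h (x n)))"
      by blast
    \<comment> \<open>Four errors of size \<open>\<delta>\<close> occur below, and \<open>2/3 - 4 / 24 = 1/2\<close>.\<close>
    define \<delta> :: real where "\<delta> = 1/24"
    have "\<delta> > 0" by (simp add: \<delta>_def)
    let ?c = "\<lambda>n. y n (v S) * L1_pairing h (x n)"
    obtain N1 where N1: "\<And>n. n \<ge> N1 \<Longrightarrow> norm ((\<Sum>i<n. ?c i) - of_real a) < \<delta>"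
      using LIMSEQ_D[OF expand[OF S h a(1), unfolded sums_def] \<open>\<delta> > 0\<close>] by blast
    define N where "N = max N0 N1"
    have N: "norm ((\<Sum>i<N. ?c i) - of_real a) < \<delta>"
      by (rule N1) (simp add: N_def)
    have IH': "real k / 2 \<le> (\<Sum>n<N. norm (y n (v S)) * norm (L1_pairing h (x n)))"
      by (rule order_trans[OF IH]) (auto intro!: sum_mono2 simp: N_def)
    define g where "g B t = (2 * indicator B t - indicator S t :: real)" for B t
    \<comment> \<open>A sequence of balanced halves with errors tending to 0: the first \<open>N\<close> terms converge to those of \<open>(S, h)\<close>,
      and a late member of the sequence serves as \<open>B\<close>.\<close>
    have "\<exists>B. B \<in> sets ?M \<and> B \<subseteq> S \<and> measure ?M B = measure ?M S / 2 \<and>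
       (\<forall>n<N. norm (y n (2 *\<^sub>R L1_indicator B - L1_indicator S)) \<le> inverse (real (Suc m)) \<and>
              norm (L1_pairing (g B) (x n)) \<le> inverse (real (Suc m)))" for m
    proof -
      have "inverse (real (Suc m)) > 0" by simp
      then obtain B where "B \<in> sets ?M" "B \<subseteq> S" "measure ?M B = measure ?M S / 2"
        "\<And>n. n < N \<Longrightarrow> norm (y n (2 *\<^sub>R L1_indicator B - L1_indicator S)) \<le> inverse (real (Suc m))"
        "\<And>n. n < N \<Longrightarrow> norm (L1_pairing (\<lambda>t. 2 * indicator B t - indicator S t) (x n)) \<le> inverse (real (Suc m))"
        by (rule balanced_subset_L1[where y = y and x = x and N = N, OF S(1) y]) blast
      then show ?thesis
        unfolding g_def by blast
    qed
    then obtain B where B: "\<And>m. B m \<in> sets ?M" "\<And>m. B m \<subseteq> S" "\<And>m. measure ?M (B m) = measure ?M S / 2"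
      and By: "\<And>n m. n < N \<Longrightarrow> norm (y n (2 *\<^sub>R L1_indicator (B m) - L1_indicator S)) \<le> inverse (real (Suc m))"
      and Bx: "\<And>n m. n < N \<Longrightarrow> norm (L1_pairing (g (B m)) (x n)) \<le> inverse (real (Suc m))"
      by metis
    define h' where "h' m t = h t + (- 2 * a) * g (B m) t" for m t
    have h'_B: "h' m t = - a" if "t \<in> B m" for m t
    proof -
      have "t \<in> S"
        using that B(2) by blast
      then show ?thesis
        using that a(1) by (simp add: h'_def g_def)
    qed
    have g: "g (B m) \<in> borel_measurable ?M" "\<And>t. \<bar>g (B m) t\<bar> \<le> 1" for m
      using B(1,2)[of m] S(1) unfolding g_def by (auto simp: indicator_def)
    have h': "h' m \<in> borel_measurable ?M" "\<And>t. \<bar>h' m t\<bar> \<le> 1" for m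
    proof -
      show "h' m \<in> borel_measurable ?M"
        unfolding h'_def using g(1)[of m] h(1) by measurable
      show "\<bar>h' m t\<bar> \<le> 1" for t
      proof (cases "t \<in> S")
        case True
        then have "h' m t = - a \<or> h' m t = 3 * a"
          using a(1) by (auto simp: h'_def g_def indicator_def)
        with a(2) show ?thesis by auto
      next
        case False
        with B(2)[of m] have "h' m t = h t"
          by (auto simp: h'_def g_def indicator_def)
        with h(2) show ?thesis by simp
      qed
    qed
    have lim0: "(\<lambda>m. inverse (real (Suc m))) \<longlonglongrightarrow> 0"
      by (rule LIMSEQ_inverse_real_of_nat)
    have lim_y: "(\<lambda>m. y n (v (B m))) \<longlonglongrightarrow> y n (v S)" if "n < N" for n
    proof -
      have lin: "linear (y n)" by (rule bounded_linear.linear[OF y])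
      have "v (B m) = v S + (2 *\<^sub>R L1_indicator (B m) - L1_indicator S) /\<^sub>R measure ?M S" for m
        by (simp add: v_def B(3) scaleR_diff_right field_simps)
      then have "y n (v (B m)) = y n (v S) + y n (2 *\<^sub>R L1_indicator (B m) - L1_indicator S) /\<^sub>R measure ?M S" for m
        by (simp only: linear_add[OF lin] linear_scale[OF lin])
      moreover have "(\<lambda>m. y n (2 *\<^sub>R L1_indicator (B m) - L1_indicator S)) \<longlonglongrightarrow> 0"
        by (rule Lim_null_comparison[OF _ lim0]) (intro always_eventually allI By that)
      ultimately show ?thesis
        by (auto intro!: tendsto_eq_intros)
    qed
    have lim_x: "(\<lambda>m. L1_pairing (h' m) (x n)) \<longlonglongrightarrow> L1_pairing h (x n)" if "n < N" for n
    proof -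
      have "L1_pairing (h' m) (x n) = L1_pairing h (x n) + (- 2 * a) *\<^sub>R L1_pairing (g (B m)) (x n)" for m
        unfolding h'_def[abs_def] by (rule L1_pairing_add[OF h g])
      moreover have "(\<lambda>m. L1_pairing (g (B m)) (x n)) \<longlonglongrightarrow> 0"
        by (rule Lim_null_comparison[OF _ lim0]) (intro always_eventually allI Bx that)
      ultimately show ?thesis
        by (auto intro!: tendsto_eq_intros)
    qed
    let ?c' = "\<lambda>m n. y n (v (B m)) * L1_pairing (h' m) (x n)"
    have "(\<lambda>m. \<Sum>n<N. ?c' m n) \<longlonglongrightarrow> (\<Sum>n<N. ?c n)" "(\<lambda>m. \<Sum>n<N. norm (?c' m n)) \<longlonglongrightarrow> (\<Sum>n<N. norm (?c n))"
      by (intro tendsto_intros lim_x lim_y; simp)+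
    then have "\<forall>\<^sub>F m in sequentially. dist (\<Sum>n<N. ?c' m n) (\<Sum>n<N. ?c n) < \<delta> \<and>
        dist (\<Sum>n<N. norm (?c' m n)) (\<Sum>n<N. norm (?c n)) < \<delta>"
      using \<open>\<delta> > 0\<close> by (intro eventually_conj) (auto dest: tendstoD)
    then obtain m where m: "dist (\<Sum>n<N. ?c' m n) (\<Sum>n<N. ?c n) < \<delta>"
        "dist (\<Sum>n<N. norm (?c' m n)) (\<Sum>n<N. norm (?c n)) < \<delta>"
      using eventually_happens[of _ sequentially] by auto
    have B_pos: "measure ?M (B m) > 0"
      by (simp only: B(3) half_gt_zero S(2))
    obtain N2 where N2: "\<And>n. n \<ge> N2 \<Longrightarrow> norm ((\<Sum>i<n. ?c' m i) - of_real (- a)) < \<delta>"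
      using LIMSEQ_D[OF expand[OF B(1) B_pos h' h'_B, unfolded sums_def] \<open>\<delta> > 0\<close>] by blast
    define N' where "N' = max N N2"
    have N': "norm ((\<Sum>i<N'. ?c' m i) - of_real (- a)) < \<delta>"
      by (rule N2) (simp add: N'_def)
    have split: "(\<Sum>i<N'. f i) = (\<Sum>i<N. f i) + (\<Sum>i\<in>{N..<N'}. f i)" for f :: "nat \<Rightarrow> 'b::comm_monoid_add"
      by (subst sum.union_disjoint[symmetric]) (auto simp: N'_def intro!: sum.cong)
    \<comment> \<open>The jump from \<open>a\<close> to \<open>-a\<close> is carried by the terms from \<open>N\<close> on, up to the tail beyond \<open>N'\<close>, the change
      of the first \<open>N\<close> terms, and the tail of the old series.\<close>
    have "2/3 = norm (of_real (- a) - of_real a :: 'k)"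
      using a(2) by (simp flip: of_real_diff of_real_minus)
    also have "\<dots> \<le> norm (\<Sum>i\<in>{N..<N'}. ?c' m i) + 3 * \<delta>"
    proof -
      have tri: "norm (p + q + r - s) \<le> norm p + norm q + norm r + norm s" for p q r s :: 'k
        using norm_triangle_ineq4[of "p + q + r" s] norm_triangle_ineq[of "p + q" r] norm_triangle_ineq[of p q]
        by linarith
      have decomp: "of_real (- a) - of_real a = (\<Sum>i\<in>{N..<N'}. ?c' m i) + ((\<Sum>i<N. ?c' m i) - (\<Sum>i<N. ?c i))
          + ((\<Sum>i<N. ?c i) - of_real a) - ((\<Sum>i<N'. ?c' m i) - of_real (- a))"
        unfolding split[of "?c' m"] by (simp only: algebra_simps)
      have "norm (of_real (- a) - of_real a :: 'k) \<le> norm (\<Sum>i\<in>{N..<N'}. ?c' m i)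
          + norm ((\<Sum>i<N. ?c' m i) - (\<Sum>i<N. ?c i))
          + norm ((\<Sum>i<N. ?c i) - of_real a) + norm ((\<Sum>i<N'. ?c' m i) - of_real (- a))"
        by (subst decomp) (rule tri)
      then show ?thesis
        using N N' m(1) unfolding dist_norm by linarith
    qed
    finally have "2/3 - 3 * \<delta> \<le> (\<Sum>i\<in>{N..<N'}. norm (?c' m i))"
      using norm_sum[of "?c' m" "{N..<N'}"] by simp
    then have "real k / 2 + 1/2 \<le> (\<Sum>n<N'. norm (?c' m n))"
      using IH' m(2) unfolding dist_real_def norm_mult \<delta>_def
        split[of "\<lambda>n. norm (y n (v (B m))) * norm (L1_pairing (h' m) (x n))"]
      by linarith
    then have "real (Suc k) / 2 \<le> (\<Sum>n<N'. norm (y n (v (B m))) * norm (L1_pairing (h' m) (x n)))"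
      by (simp add: norm_mult add_divide_distrib)
    moreover have "\<bar>- a\<bar> = 1/3"
      using a(2) by simp
    ultimately show ?case
      by (intro exI[of _ "B m"] exI[of _ "h' m"] exI[of _ "- a"] exI[of _ N'] conjI allI ballI
          B(1) B_pos h' h'_B)
  qed
  obtain k :: nat where k: "2 * A < real k"
    using reals_Archimedean2 by blast
  obtain S h N where S: "S \<in> sets ?M" "measure ?M S > 0"
    and h: "h \<in> borel_measurable ?M" "\<And>t. \<bar>h t\<bar> \<le> 1"
    and large: "real k / 2 \<le> (\<Sum>n<N. norm (y n (v S)) * norm (L1_pairing h (x n)))"
    using claim[of k] by (elim exE conjE) simp
  have "real k / 2 \<le> A * norm (v S) * onorm (L1_pairing h :: 'k L1 \<Rightarrow> 'k)"
    by (rule order_trans[OF large bessel[OF L1_pairing_in_dual_space[OF h]]])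
  also have "\<dots> \<le> A"
    using mult_left_mono[OF onorm_L1_pairing_le[OF h], of A] \<open>A > 0\<close> by (simp add: norm_v[OF S])
  finally show False using k by simp
qed

text \<open>
  Replacing \<open>y n\<close> by \<open>0\<close> for \<open>n \<notin> I\<close> turns every frame, finite or infinite, into an expansion indexed by all
  natural numbers.
\<close>

lemma no_besselian_schauder_frame_L1:
  fixes x :: "nat \<Rightarrow> 'k::{real_normed_field,euclidean_space} L1"
  shows "\<not> besselian_schauder_frame L1_scale I x y"
proof
  assume "besselian_schauder_frame L1_scale I x y"
  then obtain A where A: "A > 0"
    and y: "\<And>n. n \<in> I \<Longrightarrow> y n \<in> dual_space L1_scale"
    and exp: "\<And>v. (\<lambda>n. if n \<in> I then L1_scale (y n v) (x n) else 0) sums v"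
    and bes: "\<And>v f. f \<in> dual_space L1_scale \<Longrightarrow>
        (\<lambda>n. norm (y n v) * norm (f (x n))) summable_on I \<and>
        (\<Sum>\<^sub>\<infinity>n\<in>I. norm (y n v) * norm (f (x n))) \<le> A * norm v * onorm f"
    unfolding besselian_schauder_frame_def schauder_frame_def by blast
  define y' where "y' n = (if n \<in> I then y n else (\<lambda>_. 0))" for n
  show False
  proof (rule no_besselian_expansion[of y' x A])
    show "bounded_linear (y' n)" for n
      using y[of n] by (auto simp: y'_def dual_space_def bounded_linear_zero)
    have zero: "L1_scale 0 f = 0" for f :: "'k L1"
      using banach_space_over.norm_smul[OF banach_space_over_L1, of 0 f] by simp
    have "(\<lambda>n. L1_scale (y' n v) (x n)) = (\<lambda>n. if n \<in> I then L1_scale (y n v) (x n) else 0)" for v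
      by (auto simp: y'_def zero)
    then show "(\<lambda>n. L1_scale (y' n v) (x n)) sums v" for v
      using exp by simp
    show "(\<Sum>n<N. norm (y' n v) * norm (f (x n))) \<le> A * norm v * onorm f"
      if f: "f \<in> dual_space L1_scale" for v f N
    proof -
      have "(\<Sum>n<N. norm (y' n v) * norm (f (x n))) = (\<Sum>n\<in>{..<N} \<inter> I. norm (y n v) * norm (f (x n)))"
        by (intro sum.mono_neutral_cong_right) (auto simp: y'_def)
      also have "\<dots> \<le> (\<Sum>\<^sub>\<infinity>n\<in>I. norm (y n v) * norm (f (x n)))"
        using bes[OF f, of v] by (intro finite_sum_le_infsum) auto
      finally show ?thesis using bes[OF f, of v] by linarith
    qed
  qed (rule A)
qed

theorem corollary5p1:
  shows "\<not> (\<exists>I x y. besselian_schauder_frame (L1_scale :: real \<Rightarrow> real L1 \<Rightarrow> real L1) I x y) \<and>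
         \<not> (\<exists>I x y. besselian_schauder_frame (L1_scale :: complex \<Rightarrow> complex L1 \<Rightarrow> complex L1) I x y)"
  by (simp add: no_besselian_schauder_frame_L1)

end
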